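(* For every integer $k\geq 0$ there are infinitely many $n$ such that every nondeterministic OBDD on $n$ variables computing the partial function $\mathtt{PartialMOD^k_n}$ has width at least $2^{k+1}$.
   Context: For $\nu\in\{0,1\}^n$ let $\#_1(\nu)$ be the number of ones in $\nu$. The partial function $\mathtt{PartialMOD^k_n}$ on $\{0,1\}^n$ is defined by $\mathtt{PartialMOD^k_n}(\nu)=1$ if $\#_1(\nu)\equiv 0 \pmod{2^{k+1}}$, $\mathtt{PartialMOD^k_n}(\nu)=0$ if $\#_1(\nu)\equiv 2^k \pmod{2^{k+1}}$, and undefined otherwise. A nondeterministic OBDD (NOBDD) on variables $x_1,\dots,x_n$ with order $\pi$ (a permutation of $\{1,\dots,n\}$) is a leveled directed acyclic graph with levels $0,\dots,n$, a single source node at level $0$, where each node at level $j-1$ ($1\le j\le n$) has any number of outgoing edges, each labelled $0$ or $1$, going to nodes at level $j$; nodes at level $n$ are marked accepting or rejecting. A computation path on input $\nu$ starts at the source and at step $j$ follows some edge labelled $\nu_{\pi(j)}$; $\nu$ is accepted iff some computation path on $\nu$ ends at an accepting node. The width is the maximum number of nodes in a level. It computes a partial function $f$ if it accepts every $\nu$ with $f(\nu)=1$ and rejects every $\nu$ with $f(\nu)=0$. *)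

theory Defs
  imports "HOL-Number_Theory.Cong" "HOL-Combinatorics.Permutations"
begin

text \<open>
  Inputs from $\{0,1\}^n$ are Boolean lists of length \<open>n\<close>; variables and steps are numbered from
  \<open>0\<close>, so that the variable $x_{i+1}$ has the value \<open>\<nu> ! i\<close>.
\<close>

definition partial_mod :: "nat \<Rightarrow> nat \<Rightarrow> bool list \<Rightarrow> bool option" where
  "partial_mod k n \<nu> =
     (if length \<nu> \<noteq> n then None
      else if [count_list \<nu> True = 0] (mod 2 ^ (k + 1)) then Some True
      else if [count_list \<nu> True = 2 ^ k] (mod 2 ^ (k + 1)) then Some False
      else None)"

text \<open>
  Only the levels \<open>0, \<dots>, n\<close> and the values \<open>var_order j\<close> for \<open>j < n\<close> of a diagram on \<open>n\<close>
  variables are relevant. An edge \<open>(u, b, v)\<close> goes from \<open>u\<close> to \<open>v\<close> and carries the label \<open>b\<close>.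
\<close>

record 'v nobdd =
  var_order :: "nat \<Rightarrow> nat"
  level :: "nat \<Rightarrow> 'v set"
  source :: 'v
  edges :: "('v \<times> bool \<times> 'v) set"
  accepting :: "'v set"

definition is_nobdd :: "nat \<Rightarrow> 'v nobdd \<Rightarrow> bool" where
  "is_nobdd n B \<longleftrightarrow>
     var_order B permutes {..<n} \<and>
     (\<forall>j\<le>n. finite (level B j)) \<and>
     (\<forall>i\<le>n. \<forall>j\<le>n. i \<noteq> j \<longrightarrow> level B i \<inter> level B j = {}) \<and>
     level B 0 = {source B} \<and>
     (\<forall>(u, b, v) \<in> edges B. \<exists>j<n. u \<in> level B j \<and> v \<in> level B (Suc j)) \<and>
     accepting B \<subseteq> level B n"

definition computation_path :: "nat \<Rightarrow> 'v nobdd \<Rightarrow> bool list \<Rightarrow> (nat \<Rightarrow> 'v) \<Rightarrow> bool" where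
  "computation_path n B \<nu> p \<longleftrightarrow>
     p 0 = source B \<and> (\<forall>j<n. (p j, \<nu> ! var_order B j, p (Suc j)) \<in> edges B)"

definition accepts :: "nat \<Rightarrow> 'v nobdd \<Rightarrow> bool list \<Rightarrow> bool" where
  "accepts n B \<nu> \<longleftrightarrow> (\<exists>p. computation_path n B \<nu> p \<and> p n \<in> accepting B)"

definition computes :: "nat \<Rightarrow> 'v nobdd \<Rightarrow> (bool list \<Rightarrow> bool option) \<Rightarrow> bool" where
  "computes n B f \<longleftrightarrow>
     (\<forall>\<nu>. length \<nu> = n \<longrightarrow>
        (f \<nu> = Some True \<longrightarrow> accepts n B \<nu>) \<and> (f \<nu> = Some False \<longrightarrow> \<not> accepts n B \<nu>))"

definition width :: "nat \<Rightarrow> 'v nobdd \<Rightarrow> nat" where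
  "width n B = Max ((\<lambda>j. card (level B j)) ` {0..n})"

end

theory Submission
  imports Defs "HOL-Library.Ramsey"
begin

text \<open>
  Suppose that all levels have fewer than \<open>N = 2 ^ (k + 1)\<close> nodes and name the nodes of each level by
  numbers below \<open>N - 1\<close>. Colour a pair of levels \<open>a < b\<close> by the two relations between node names
  that are induced by reading only zeros from \<open>a\<close> to \<open>b\<close>, and by reading a one followed by zeros.
  If there are enough levels, Ramsey's theorem yields many levels \<open>h 0 < h 1 < \<dots>\<close> all pairs of
  which have the same colour \<open>(Z, W)\<close>. On inputs whose ones are read exactly at the levels
  \<open>h 0, \<dots>, h (m - 1)\<close> the diagram then behaves like a unary automaton with transition relation
  \<open>W\<close> and fewer than \<open>N\<close> states. An accepting path for \<open>m = N\<close> therefore contains a cycle of some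
  length \<open>0 < c < N\<close>, and since the exponent of 2 in \<open>c\<close> is at most \<open>k\<close>, some multiple
  \<open>r * c\<close> is congruent to \<open>2 ^ k\<close> modulo \<open>N\<close>. Pumping the cycle \<open>r\<close> times leads to the acceptance
  of an input with \<open>N + r * c\<close> ones, which has to be rejected.
\<close>

section \<open>Homogeneous sequences from Ramsey's theorem\<close>

text \<open>Finite Ramsey theorem for pairs, with the homogeneous set enumerated increasingly. The
  threshold \<open>R\<close> depends only on \<open>C\<close> and \<open>m\<close>, so one threshold
  will serve all diagrams.\<close>

lemma exists_homogeneous_sequence:
  fixes C :: "'c set" and m :: nat
  assumes "finite C"
  shows "\<exists>R. \<forall>n\<ge>R. \<forall>c :: nat \<Rightarrow> nat \<Rightarrow> 'c. (\<forall>a b. a < b \<longrightarrow> b < n \<longrightarrow> c a b \<in> C) \<longrightarrow>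
    (\<exists>h z. strict_mono_on {..<m} h \<and> h ` {..<m} \<subseteq> {..<n} \<and>
           (\<forall>i j. i < j \<longrightarrow> j < m \<longrightarrow> c (h i) (h j) = z))"
proof -
  obtain g where g: "bij_betw g C {0..<card C}"
    using ex_bij_betw_finite_nat[OF assms] by blast
  obtain R :: nat where R: "partn_lst {..<R} (replicate (card C) m) 2"
    using ramsey_full by blast
  have "\<exists>h z. strict_mono_on {..<m} h \<and> h ` {..<m} \<subseteq> {..<n} \<and>
           (\<forall>i j. i < j \<longrightarrow> j < m \<longrightarrow> c (h i) (h j) = z)"
    if "n \<ge> R" and c: "\<forall>a b. a < b \<longrightarrow> b < n \<longrightarrow> c a b \<in> C" for n and c :: "nat \<Rightarrow> nat \<Rightarrow> 'c"
  proof -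
    have Rn: "partn_lst {..<n} (replicate (card C) m) 2"
      using R \<open>n \<ge> R\<close> by (rule partn_lst_greater_resource)
    \<comment> \<open>Ramsey's theorem colours unordered pairs by numbers: \<open>Min\<close> and
      \<open>Max\<close> recover the order, and \<open>g\<close> numbers the colours.\<close>
    define f where "f X = g (c (Min X) (Max X))" for X
    have f_pair: "f {a, b} = g (c a b)" if "a < b" for a b
      using that by (simp add: f_def)
    have "f \<in> nsets {..<n} 2 \<rightarrow> {..<card C}"
      using c g by (auto simp: ordered_nsets_2_eq f_pair bij_betw_def)
    then obtain i where i: "i < card C" "monochromatic {..<n} m 2 f i"
      using Rn by (auto simp: partn_lst_def)
    then obtain H where H: "H \<in> nsets {..<n} m" "f ` nsets H 2 \<subseteq> {i}"
      by (auto simp: monochromatic_def)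
    then have fin: "finite H" and card: "card H = m" and sub: "H \<subseteq> {..<n}"
      by (auto simp: nsets_def)
    obtain h where h: "bij_betw h {..<m} H" "strict_mono_on {..<m} h"
      using ex_bij_betw_strict_mono_card[OF fin] card by metis
    have himg: "h ` {..<m} = H"
      using h by (simp add: bij_betw_def)
    have "c (h a) (h b) = inv_into C g i" if "a < b" "b < m" for a b
    proof -
      have lt: "h a < h b"
        using h(2) that by (auto simp: strict_mono_on_def)
      have mem: "h a \<in> H" "h b \<in> H"
        using that himg by auto
      with lt have "{h a, h b} \<in> nsets H 2"
        by auto
      then have "g (c (h a) (h b)) = i"
        using H(2) f_pair[OF lt] by (metis image_subset_iff singletonD)
      moreover have "c (h a) (h b) \<in> C"
        using c lt mem sub by auto
      ultimately show ?thesis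
        using g by (metis bij_betw_def inv_into_f_f)
    qed
    then show ?thesis
      using h(2) himg sub by blast
  qed
  then show ?thesis
    by blast
qed

section \<open>Multiples modulo a power of two\<close>

text \<open>If \<open>2 ^ a\<close> is the exact power of 2 in \<open>c\<close>, then
  \<open>a\<close> is at most \<open>k\<close>, and \<open>r = 2 ^ (k - a)\<close> makes
  \<open>r * c\<close> an odd multiple of \<open>2 ^ k\<close>. The bound on \<open>r\<close> limits
  how many levels pumping can use up.\<close>

lemma exists_multiple_cong_power_two:
  fixes c k :: nat
  assumes "0 < c" "c < 2 ^ (k + 1)"
  shows "\<exists>r \<le> 2 ^ k. [r * c = 2 ^ k] (mod 2 ^ (k + 1))"
proof -
  obtain o' where o': "c = 2 ^ multiplicity 2 c * o'" "\<not> 2 dvd o'"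
    using multiplicity_decompose'[of c 2] assms by auto
  define a where "a = multiplicity 2 c"
  have c: "c = 2 ^ a * o'"
    using o' by (simp add: a_def)
  obtain t where t: "o' = 2 * t + 1"
    using o'(2) by (auto elim: oddE)
  have "(2::nat) ^ a \<le> c"
    using c t by simp
  then have "(2::nat) ^ a < 2 ^ (k + 1)"
    using assms by simp
  then have "a \<le> k"
    by (simp add: power_strict_increasing_iff less_Suc_eq_le del: power_Suc)
  then have "2 ^ (k - a) * c = 2 ^ k * o'"
    using c by (simp add: power_add[symmetric] flip: mult.assoc)
  also have "\<dots> = 2 ^ (k + 1) * t + 2 ^ k"
    using t by (simp add: algebra_simps)
  finally have "[2 ^ (k - a) * c = 2 ^ k] (mod 2 ^ (k + 1))"
    by (simp add: cong_def)
  moreover have "(2::nat) ^ (k - a) \<le> 2 ^ k"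
    by simp
  ultimately show ?thesis
    by blast
qed

section \<open>Walks in a relation\<close>

lemma relpow_segment:
  assumes "\<And>i. a \<le> i \<Longrightarrow> i < a + d \<Longrightarrow> (s i, s (Suc i)) \<in> W"
  shows "(s a, s (a + d)) \<in> W ^^ d"
  using assms by (induction d) auto

lemma relpow_cycle:
  assumes "(x, x) \<in> W ^^ c"
  shows "(x, x) \<in> W ^^ (r * c)"
  using assms by (induction r) (auto simp: relpow_add)

section \<open>Runs between two levels\<close>

text \<open>Here \<open>x j\<close> is the bit read at step \<open>j\<close>, whichever variable is
  queried there, so runs can be cut and glued without regard to the variable order.\<close>

definition run :: "('v \<times> bool \<times> 'v) set \<Rightarrow> (nat \<Rightarrow> bool) \<Rightarrow> nat \<Rightarrow> nat \<Rightarrow> 'v \<Rightarrow> 'v \<Rightarrow> bool" where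
  "run E x a b u v \<longleftrightarrow>
     (\<exists>p. p a = u \<and> p b = v \<and> (\<forall>j. a \<le> j \<longrightarrow> j < b \<longrightarrow> (p j, x j, p (Suc j)) \<in> E))"

lemma run_trans:
  assumes "run E x a b u v" "run E x b c v w" "a \<le> b" "b \<le> c"
  shows "run E x a c u w"
proof -
  obtain p where p: "p a = u" "p b = v" "\<And>j. a \<le> j \<Longrightarrow> j < b \<Longrightarrow> (p j, x j, p (Suc j)) \<in> E"
    using assms(1) by (auto simp: run_def)
  obtain q where q: "q b = v" "q c = w" "\<And>j. b \<le> j \<Longrightarrow> j < c \<Longrightarrow> (q j, x j, q (Suc j)) \<in> E"
    using assms(2) by (auto simp: run_def)
  define s where "s j = (if j \<le> b then p j else q j)" for j
  have "(s j, x j, s (Suc j)) \<in> E" if "a \<le> j" "j < c" for j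
  proof (cases j b rule: linorder_cases)
    case less
    then show ?thesis
      using p(3) that by (simp add: s_def)
  next
    case equal
    then show ?thesis
      using p(2) q(1) q(3)[of b] that by (simp add: s_def)
  next
    case greater
    then show ?thesis
      using q(3) that by (simp add: s_def)
  qed
  moreover have "s a = u" "s c = w"
    using assms(3,4) p q by (auto simp: s_def)
  ultimately show ?thesis
    unfolding run_def by blast
qed

lemma run_cong:
  assumes "run E x a b u v" "\<And>j. a \<le> j \<Longrightarrow> j < b \<Longrightarrow> x j = y j"
  shows "run E y a b u v"
proof -
  obtain p where p: "p a = u" "p b = v" "\<And>j. a \<le> j \<Longrightarrow> j < b \<Longrightarrow> (p j, x j, p (Suc j)) \<in> E"
    using assms(1) by (auto simp: run_def)
  have "(p j, y j, p (Suc j)) \<in> E" if "a \<le> j" "j < b" for j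
    using p(3)[OF that] assms(2)[OF that] by simp
  with p(1,2) show ?thesis
    unfolding run_def by blast
qed

section \<open>Inputs given in reading order\<close>

text \<open>Step \<open>j\<close> queries variable \<open>\<pi> j\<close>, so variable
  \<open>i\<close> takes the bit of step \<open>inv \<pi> i\<close>.\<close>

definition input_of :: "nat \<Rightarrow> (nat \<Rightarrow> nat) \<Rightarrow> (nat \<Rightarrow> bool) \<Rightarrow> bool list" where
  "input_of n \<pi> x = map (\<lambda>i. x (inv \<pi> i)) [0..<n]"

lemma length_input_of [simp]: "length (input_of n \<pi> x) = n"
  by (simp add: input_of_def)

lemma nth_input_of:
  assumes "\<pi> permutes {..<n}" "j < n"
  shows "input_of n \<pi> x ! \<pi> j = x j"
proof -
  have "\<pi> j < n"
    using permutes_in_image[OF assms(1), of j] assms(2) by simp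
  then show ?thesis
    by (simp add: input_of_def permutes_inverses[OF assms(1)])
qed

lemma count_list_map_upt: "count_list (map f [0..<n]) True = card {i. i < n \<and> f i}"
proof (induction n)
  case (Suc n)
  have "{i. i < Suc n \<and> f i} = {i. i < n \<and> f i} \<union> (if f n then {n} else {})"
    by (auto simp: less_Suc_eq)
  then show ?case
    using Suc by simp
qed simp

lemma count_list_input_of:
  assumes "\<pi> permutes {..<n}"
  shows "count_list (input_of n \<pi> x) True = card {j. j < n \<and> x j}"
proof -
  have inv_less: "inv \<pi> i < n \<longleftrightarrow> i < n" for i
    using permutes_in_image[OF permutes_inv[OF assms], of i] by simp
  have "bij_betw (inv \<pi>) {i. i < n \<and> x (inv \<pi> i)} {j. j < n \<and> x j}"
  proof (rule bij_betw_byWitness[where f' = \<pi>])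
    show "\<pi> ` {j. j < n \<and> x j} \<subseteq> {i. i < n \<and> x (inv \<pi> i)}"
      using permutes_in_image[OF assms] by (simp add: image_subset_iff permutes_inverses(2)[OF assms])
  qed (simp_all add: permutes_inverses[OF assms] image_subset_iff inv_less)
  then show ?thesis
    unfolding input_of_def count_list_map_upt by (rule bij_betw_same_card)
qed

lemma accepts_input_of_iff:
  assumes "var_order B permutes {..<n}"
  shows "accepts n B (input_of n (var_order B) x) \<longleftrightarrow>
    (\<exists>v \<in> accepting B. run (edges B) x 0 n (source B) v)"
  unfolding accepts_def computation_path_def run_def
  by (auto simp: nth_input_of[OF assms])

text \<open>Every edge joins consecutive levels, and disjointness of the levels leaves
  \<open>j\<close> as the only possible level of \<open>p j\<close>.\<close>

lemma path_in_level:
  assumes "is_nobdd n B" "p 0 = source B"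
    and "\<And>j. j < n \<Longrightarrow> (p j, x j, p (Suc j)) \<in> edges B" "j \<le> n"
  shows "p j \<in> level B j"
  using \<open>j \<le> n\<close>
proof (induction j)
  case 0
  then show ?case
    using assms by (simp add: is_nobdd_def)
next
  case (Suc j)
  then have "(p j, x j, p (Suc j)) \<in> edges B"
    using assms(3) by simp
  then obtain i where i: "i < n" "p j \<in> level B i" "p (Suc j) \<in> level B (Suc i)"
    using assms(1) unfolding is_nobdd_def by blast
  moreover have "i = j"
    using assms(1) i Suc unfolding is_nobdd_def by (metis Suc_leD disjoint_iff less_imp_le)
  ultimately show ?case
    by simp
qed

section \<open>Transition relations on node names\<close>

text \<open>Passing from nodes to names puts the relations of all pairs of levels into one finite
  set, where they can serve as colours.\<close>

definition named_runs ::
  "'v nobdd \<Rightarrow> (nat \<Rightarrow> 'v \<Rightarrow> nat) \<Rightarrow> (nat \<Rightarrow> bool) \<Rightarrow> nat \<Rightarrow> nat \<Rightarrow> (nat \<times> nat) set" where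
  "named_runs B e x a b =
     {(e a u, e b v) | u v. u \<in> level B a \<and> v \<in> level B b \<and> run (edges B) x a b u v}"

text \<open>Injective naming at level \<open>a\<close> forces the run witnessing
  \<open>(s, t)\<close> to start at the given node \<open>u\<close>; this is what allows runs to be
  chained.\<close>

lemma named_runsE:
  assumes "(s, t) \<in> named_runs B e x a b" "inj_on (e a) (level B a)"
    and "u \<in> level B a" "e a u = s"
  obtains v where "v \<in> level B b" "e b v = t" "run (edges B) x a b u v"
  using assms by (auto simp: named_runs_def dest: inj_onD)

section \<open>The pumping argument\<close>

theorem theorem3:
  fixes k :: nat
  shows "infinite {n :: nat. \<forall>B :: 'v nobdd.
           is_nobdd n B \<longrightarrow> computes n B (partial_mod k n) \<longrightarrow> 2 ^ (k + 1) \<le> width n B}"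
proof -
  define N :: nat where "N = 2 ^ (k + 1)"
  \<comment> \<open>The pumped input will have \<open>N + r * c\<close> ones with \<open>r\<close>
    and \<open>c\<close> at most \<open>N\<close>, hence fewer than \<open>T\<close>. A further
    level \<open>h T\<close> serves as a common meeting point, so \<open>Suc T\<close> levels are
    requested.\<close>
  define T where "T = N + N * N + 1"
  define S where "S = {..<N - 1}"
  define C where "C = Pow (S \<times> S) \<times> Pow (S \<times> S)"
  have "N \<ge> 2"
    by (simp add: N_def)
  have "finite C"
    by (simp add: C_def S_def)
  from exists_homogeneous_sequence[OF this, of "Suc T"]
  obtain R where R: "\<forall>n\<ge>R. \<forall>c :: nat \<Rightarrow> nat \<Rightarrow> _. (\<forall>a b. a < b \<longrightarrow> b < n \<longrightarrow> c a b \<in> C) \<longrightarrow>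
    (\<exists>h z. strict_mono_on {..<Suc T} h \<and> h ` {..<Suc T} \<subseteq> {..<n} \<and>
           (\<forall>i j. i < j \<longrightarrow> j < Suc T \<longrightarrow> c (h i) (h j) = z))"
    by (elim exE)
  have "N \<le> width n B"
    if "n \<ge> R" and B: "is_nobdd n B" and comp: "computes n B (partial_mod k n)"
    for n and B :: "'v nobdd"
  proof (rule ccontr)
    assume "\<not> N \<le> width n B"
    have perm: "var_order B permutes {..<n}"
      using B by (simp add: is_nobdd_def)
    have "\<exists>f. inj_on f (level B j) \<and> f ` level B j \<subseteq> S" if "j \<le> n" for j
    proof -
      have fin: "finite (level B j)"
        using B that by (simp add: is_nobdd_def)
      have "card (level B j) \<le> width n B"
        unfolding width_def using that by (intro Max_ge) auto
      then have "card (level B j) \<le> card S"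
        using \<open>\<not> N \<le> width n B\<close> by (simp add: S_def)
      then show ?thesis
        using card_le_inj[OF fin, of S] by (auto simp: S_def)
    qed
    then obtain e where inj: "\<And>j. j \<le> n \<Longrightarrow> inj_on (e j) (level B j)"
      and names: "\<And>j. j \<le> n \<Longrightarrow> e j ` level B j \<subseteq> S"
      by metis
    have "named_runs B e x a b \<subseteq> S \<times> S" if "a < b" "b < n" for x a b
      using names[of a] names[of b] that by (auto simp: named_runs_def)
    then have "\<forall>a b. a < b \<longrightarrow> b < n \<longrightarrow>
        (named_runs B e (\<lambda>_. False) a b, named_runs B e (\<lambda>j. j = a) a b) \<in> C"
      by (auto simp: C_def)
    from R[THEN spec, THEN mp, OF \<open>n \<ge> R\<close>, THEN spec, THEN mp, OF this] obtain h z
      where mono: "strict_mono_on {..<Suc T} h" and bound: "h ` {..<Suc T} \<subseteq> {..<n}"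
        and z: "\<forall>i j. i < j \<longrightarrow> j < Suc T \<longrightarrow>
          (named_runs B e (\<lambda>_. False) (h i) (h j), named_runs B e (\<lambda>l. l = h i) (h i) (h j)) = z"
      by (elim exE conjE)
    define Z where "Z = fst z"
    define W where "W = snd z"
    have Z: "named_runs B e (\<lambda>_. False) (h i) (h j) = Z"
      and W: "named_runs B e (\<lambda>l. l = h i) (h i) (h j) = W" if "i < j" "j < Suc T" for i j
      using z[THEN spec, THEN spec, of i j] that unfolding Z_def W_def
      by (metis fst_conv, metis snd_conv)
    have h_less_iff: "h i < h j \<longleftrightarrow> i < j" if "i \<le> T" "j \<le> T" for i j
      using that strict_mono_on_less[OF mono] by simp
    have h_le_iff: "h i \<le> h j \<longleftrightarrow> i \<le> j" if "i \<le> T" "j \<le> T" for i j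
      using h_less_iff that by (meson linorder_not_less)
    have h_eq_iff: "h i = h j \<longleftrightarrow> i = j" if "i \<le> T" "j \<le> T" for i j
      using h_le_iff[of i j] h_le_iff[of j i] that by auto
    have h_less: "h i < n" if "i \<le> T" for i
      using bound that by (simp add: image_subset_iff)
    \<comment> \<open>Bits in reading order with ones exactly at the steps leaving
      \<open>h 0\<close>, ..., \<open>h (m - 1)\<close>.\<close>
    define X where "X m j \<longleftrightarrow> (\<exists>i<m. j = h i)" for m j
    have X_False: "\<not> X m j" if "m \<le> i" "i \<le> T" "h i \<le> j" for m i j
    proof
      assume "X m j"
      then obtain i' where "i' < m" "j = h i'"
        by (auto simp: X_def)
      then show False
        using that h_le_iff[of i i'] by simp
    qed
    have X_before: "\<not> X m j" if "m \<le> T" "j < h 0" for m j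
    proof
      assume "X m j"
      then obtain i where "i < m" "j = h i"
        by (auto simp: X_def)
      then show False
        using that h_less_iff[of i 0] by simp
    qed
    have X_block: "X m j \<longleftrightarrow> j = h i" if "m \<le> T" "i < m" "h i \<le> j" "j < h (Suc i)" for m i j
    proof
      assume "X m j"
      then obtain i' where i': "i' < m" "j = h i'"
        by (auto simp: X_def)
      then have "i \<le> i'" "i' < Suc i"
        using that h_le_iff[of i i'] h_less_iff[of i' "Suc i"] by auto
      then show "j = h i"
        using i' by (simp add: less_Suc_eq_le)
    qed (use that in \<open>auto simp: X_def\<close>)
    have weight: "count_list (input_of n (var_order B) (X m)) True = m" if "m \<le> T" for m
    proof -
      have "{j. j < n \<and> X m j} = h ` {..<m}"
        using h_less that by (auto simp: X_def)
      moreover have "inj_on h {..<m}"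
        using h_eq_iff that by (auto simp: inj_on_def)
      ultimately show ?thesis
        using perm by (simp add: count_list_input_of card_image)
    qed
    have "N < T"
      by (simp add: T_def)
    have "partial_mod k n (input_of n (var_order B) (X N)) = Some True"
      using weight[of N] \<open>N < T\<close> by (simp add: partial_mod_def N_def cong_def)
    then have "accepts n B (input_of n (var_order B) (X N))"
      using comp by (simp add: computes_def)
    then obtain p where p0: "p 0 = source B" and pn: "p n \<in> accepting B"
      and pE: "\<And>j. j < n \<Longrightarrow> (p j, X N j, p (Suc j)) \<in> edges B"
      using accepts_input_of_iff[OF perm] by (auto simp: run_def)
    have plev: "p j \<in> level B j" if "j \<le> n" for j
      using path_in_level[where p = p and x = "X N", OF B p0 pE that] by simp
    have prun: "run (edges B) (X N) a b (p a) (p b)" if "b \<le> n" for a b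
      using pE that unfolding run_def by (intro exI[of _ p]) auto
    define s where "s i = e (h i) (p (h i))" for i
    have sS: "s i \<in> S" if "i \<le> T" for i
      using names[of "h i"] plev[of "h i"] h_less[OF that] by (auto simp: s_def)
    have sW: "(s i, s (Suc i)) \<in> W" if "i < N" for i
    proof -
      have "run (edges B) (\<lambda>j. j = h i) (h i) (h (Suc i)) (p (h i)) (p (h (Suc i)))"
        using that \<open>N < T\<close> h_less[of "Suc i"] X_block[of N i]
        by (intro run_cong[OF prun[of "h (Suc i)" "h i"]]) auto
      then have "(s i, s (Suc i)) \<in> named_runs B e (\<lambda>j. j = h i) (h i) (h (Suc i))"
        using plev h_less[of i] h_less[of "Suc i"] that \<open>N < T\<close>
        by (force simp: named_runs_def s_def)
      then show ?thesis
        using W[of i "Suc i"] that \<open>N < T\<close> by simp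
    qed
    \<comment> \<open>From \<open>h N\<close> to \<open>h T\<close> the accepting path reads only
      zeros; this stretch will later be replaced by one from \<open>h q\<close> to
      \<open>h T\<close>.\<close>
    have sZ: "(s N, s T) \<in> Z"
    proof -
      have "run (edges B) (\<lambda>_. False) (h N) (h T) (p (h N)) (p (h T))"
        using \<open>N < T\<close> h_less[of T] X_False[of N N]
        by (intro run_cong[OF prun[of "h T" "h N"]]) auto
      then have "(s N, s T) \<in> named_runs B e (\<lambda>_. False) (h N) (h T)"
        using plev h_less[of N] h_less[of T] \<open>N < T\<close> by (force simp: named_runs_def s_def)
      then show ?thesis
        using Z[of N T] \<open>N < T\<close> by simp
    qed
    \<comment> \<open>Pigeonhole: \<open>N\<close> indices share \<open>N - 1\<close> names, so a
      name repeats.\<close>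
    have "s ` {..<N} \<subseteq> S"
      using sS \<open>N < T\<close> by auto
    then have "card (s ` {..<N}) \<le> card S"
      by (intro card_mono) (auto simp: S_def)
    also have "\<dots> < card {..<N}"
      using \<open>N \<ge> 2\<close> by (simp add: S_def)
    finally have "\<not> inj_on s {..<N}"
      by (rule pigeonhole)
    then obtain a b where ab: "a < b" "b < N" "s a = s b"
      by (metis inj_on_def lessThan_iff linorder_neqE_nat)
    define c where "c = b - a"
    have "0 < c" "c < 2 ^ (k + 1)"
      using ab by (simp_all add: c_def N_def)
    then obtain r where r: "r \<le> 2 ^ k" "[r * c = 2 ^ k] (mod 2 ^ (k + 1))"
      using exists_multiple_cong_power_two by blast
    define q where "q = N + r * c"
    have "r \<le> N"
      using r(1) by (simp add: N_def)
    moreover have "c \<le> N"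
      using ab by (simp add: c_def)
    ultimately have "q < T"
      by (simp add: q_def T_def mult_le_mono less_Suc_eq_le)
    have "(s 0, s a) \<in> W ^^ a"
      using relpow_segment[of 0 a s W] sW ab by simp
    moreover have "(s a, s a) \<in> W ^^ (r * c)"
      using relpow_segment[of a c s W] sW ab by (intro relpow_cycle) (simp add: c_def)
    moreover have "(s a, s N) \<in> W ^^ (N - a)"
      using relpow_segment[of a "N - a" s W] sW ab by simp
    \<comment> \<open>Walk to the repeated name, go round the cycle \<open>r\<close> times, then
      continue to \<open>s N\<close>.\<close>
    ultimately have "(s 0, s N) \<in> W ^^ (a + (r * c + (N - a)))"
      unfolding relpow_add by blast
    moreover have "a + (r * c + (N - a)) = q"
      using ab by (simp add: q_def)
    ultimately have pumped: "(s 0, s N) \<in> W ^^ q"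
      by simp
    \<comment> \<open>A walk on names becomes a genuine run on the pumped input: by homogeneity, its
      \<open>i\<close>-th \<open>W\<close>-step can be realised between \<open>h i\<close> and
      \<open>h (Suc i)\<close>.\<close>
    have lift: "\<exists>v \<in> level B (h i). e (h i) v = t \<and> run (edges B) (X q) (h 0) (h i) (p (h 0)) v"
      if "(s 0, t) \<in> W ^^ i" "i \<le> q" for i t
      using that
    proof (induction i arbitrary: t)
      case 0
      have "run (edges B) (X q) (h 0) (h 0) (p (h 0)) (p (h 0))"
        by (auto simp: run_def)
      then show ?case
        using 0 plev[of "h 0"] h_less[of 0] by (auto simp: s_def)
    next
      case (Suc i)
      then obtain t' where t': "(s 0, t') \<in> W ^^ i" "(t', t) \<in> W"
        by auto
      then obtain u where u: "u \<in> level B (h i)" "e (h i) u = t'"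
        "run (edges B) (X q) (h 0) (h i) (p (h 0)) u"
        using Suc by force
      have "(t', t) \<in> named_runs B e (\<lambda>j. j = h i) (h i) (h (Suc i))"
        using W[of i "Suc i"] t' Suc.prems \<open>q < T\<close> by simp
      then obtain v where v: "v \<in> level B (h (Suc i))" "e (h (Suc i)) v = t"
        "run (edges B) (\<lambda>j. j = h i) (h i) (h (Suc i)) u v"
        using inj[of "h i"] h_less[of i] u Suc.prems \<open>q < T\<close> by (elim named_runsE) auto
      have "run (edges B) (X q) (h i) (h (Suc i)) u v"
        using X_block[of q i] Suc.prems \<open>q < T\<close> by (intro run_cong[OF v(3)]) auto
      with u(3) have "run (edges B) (X q) (h 0) (h (Suc i)) (p (h 0)) v"
        by (rule run_trans) (use h_le_iff Suc.prems \<open>q < T\<close> in auto)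
      then show ?case
        using v by blast
    qed
    obtain v where v: "v \<in> level B (h q)" "e (h q) v = s N"
      "run (edges B) (X q) (h 0) (h q) (p (h 0)) v"
      using lift[OF pumped] by blast
    \<comment> \<open>Homogeneity moves the zero stretch: \<open>Z\<close> is also the relation
      between \<open>h q\<close> and \<open>h T\<close>.\<close>
    have "(s N, s T) \<in> named_runs B e (\<lambda>_. False) (h q) (h T)"
      using sZ Z[of q T] \<open>q < T\<close> by simp
    then obtain w where w: "w \<in> level B (h T)" "e (h T) w = s T"
      "run (edges B) (\<lambda>_. False) (h q) (h T) v w"
      using inj[of "h q"] h_less[of q] v \<open>q < T\<close> by (elim named_runsE) auto
    \<comment> \<open>Equal names within one level mean equal nodes, so the pumped run rejoins the
      original path and can follow it to acceptance.\<close>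
    have "w = p (h T)"
      using inj[of "h T"] h_less[of T] plev[of "h T"] w by (auto simp: s_def dest: inj_onD)
    have "run (edges B) (X q) 0 (h 0) (source B) (p (h 0))"
      using h_less[of 0] X_before[of N] X_before[of q] \<open>N < T\<close> \<open>q < T\<close>
      by (intro run_cong[OF prun[of "h 0" 0, unfolded p0]]) auto
    then have "run (edges B) (X q) 0 (h q) (source B) v"
      by (rule run_trans[OF _ v(3)]) (use h_le_iff[of 0 q] \<open>q < T\<close> in auto)
    moreover have "run (edges B) (X q) (h q) (h T) v (p (h T))"
      using X_False[of q q] \<open>q < T\<close>
      by (intro run_cong[OF w(3)[unfolded \<open>w = p (h T)\<close>]]) auto
    ultimately have "run (edges B) (X q) 0 (h T) (source B) (p (h T))"
      by (rule run_trans) (use h_le_iff[of q T] \<open>q < T\<close> in auto)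
    moreover have "run (edges B) (X q) (h T) n (p (h T)) (p n)"
      using X_False[of N T] X_False[of q T] \<open>N < T\<close> \<open>q < T\<close>
      by (intro run_cong[OF prun[of n "h T"]]) auto
    ultimately have "run (edges B) (X q) 0 n (source B) (p n)"
      by (rule run_trans) (use h_less[of T] in auto)
    then have "accepts n B (input_of n (var_order B) (X q))"
      using accepts_input_of_iff[OF perm] pn by blast
    moreover have "partial_mod k n (input_of n (var_order B) (X q)) = Some False"
    proof -
      have "[q = 2 ^ k] (mod 2 ^ (k + 1))"
        using r(2) by (simp add: q_def N_def cong_def)
      \<comment> \<open>\<open>partial_mod\<close> tests residue 0 first, so that case must be
        excluded.\<close>
      moreover have "\<not> [2 ^ k = 0 :: nat] (mod 2 ^ (k + 1))"
        by (simp add: cong_def)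
      ultimately show ?thesis
        using weight[of q] \<open>q < T\<close> by (simp add: partial_mod_def cong_def)
    qed
    ultimately show False
      using comp by (simp add: computes_def)
  qed
  then have "{R..} \<subseteq> {n. \<forall>B :: 'v nobdd.
      is_nobdd n B \<longrightarrow> computes n B (partial_mod k n) \<longrightarrow> 2 ^ (k + 1) \<le> width n B}"
    by (auto simp: N_def)
  then show ?thesis
    using infinite_Ici infinite_super by blast
qed

end
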